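(* Let $g\in C([0,T];\mathbb R)$ satisfy $$\|g\|_{L^1(0,T)}\le\frac1{\varepsilon_\circ}\bigl(\bar v-v_{\ell,\circ}-\|\mathsf a_\ell\|_{L^1(0,T)}\bigr)$$ for some $\varepsilon_\circ>0$. For $0<\varepsilon\le\varepsilon_\circ$ let $(x_\ell^\varepsilon,x^\varepsilon,v_\ell^\varepsilon,v^\varepsilon)$ be the solution on $[0,T]$ of the perturbed system $$\dot x^\varepsilon_\ell=v^\varepsilon_\ell,\quad \dot v^\varepsilon_\ell=\mathsf a_\ell+\varepsilon g,\quad \dot x^\varepsilon=v^\varepsilon,\quad \dot v^\varepsilon=\mathcal A(x^\varepsilon_\ell,x^\varepsilon,v^\varepsilon_\ell,v^\varepsilon;u),$$ and let $(x_\ell,x,v_\ell,v)$ be the solution on $[0,T]$ of the unperturbed system $$\dot x_\ell=v_\ell,\quad \dot v_\ell=\mathsf a_\ell,\quad \dot x=v,\quad \dot v=\mathcal A(x_\ell,x,v_\ell,v;u),$$ both with the same initial condition $(x_{\ell,\circ},x_\circ,v_{\ell,\circ},v_\circ)\in\mathcal S$ at $t=0$. Set $\xi^\varepsilon=x_\ell^\varepsilon-x^\varepsilon$, $\zeta^\varepsilon=v_\ell^\varepsilon-v^\varepsilon$, $\xi=x_\ell-x$, $\zeta=v_\ell-v$. Then $$\bigl\|(\xi^\varepsilon,\zeta^\varepsilon)-(\xi,\zeta)\bigr\|_{L^\infty(0,T)}\to0\quad\text{as }\varepsilon\to0 .$$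
   Context: Fixed data: constants $k_v,k_d,k,\tau_s>0$; constants $0<\underline u<\bar u<\bar v<\infty$; a time horizon $T>0$; a control $u\in C([0,T];[\underline u,\bar u])$; a leader acceleration $\mathsf a_\ell\in C([0,T];\mathbb R)\cap L^\infty([0,T];\mathbb R)$ such that $0\le v_{\ell,\circ}+\int_0^t\mathsf a_\ell(s)\,ds\le\bar v$ for all $t\in[0,T]$. The acceleration of the following vehicle is $$\mathcal A(x_\ell,x,v_\ell,v;u)=\min\Bigl\{k_v\frac{v_\ell-v}{(x_\ell-x)^2}+k_d(x_\ell-x-\tau_s v),\;k(u-v)\Bigr\},$$ where $u=u(t)$ is evaluated at the current time. The state space is $\mathcal S=\{(x_1,x_2,v_1,v_2)\in\mathbb R^2\times\mathbb R_+^2:\ x_1-x_2>0,\ v_1,v_2\in[0,\bar v]\}$, with $\mathbb R_+=[0,\infty)$. Solution (for either system): a function in $W^{1,\infty}((0,T);\mathcal S)$, identified with its continuous representative on $[0,T]$ taking values in $\mathcal S$ (so in particular the leader's velocity stays in $[0,\bar v]$), which satisfies the equations and the initial condition in integral form for all $t\in[0,T]$. The vector norm on $\mathbb R^2$ is the Euclidean norm. *)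

theory Defs
  imports "HOL-Analysis.Analysis" "HOL-Probability.Essential_Supremum"
begin

definition L1_norm :: "real \<Rightarrow> (real \<Rightarrow> real) \<Rightarrow> real" where
  "L1_norm T f = (LINT t|lebesgue_on {0<..<T}. \<bar>f t\<bar>)"

(* Valued in ereal, so that an essentially unbounded function has norm infinity
   (esssup is also infinite whenever the norm of f is not measurable). *)
definition Linf_norm :: "real \<Rightarrow> (real \<Rightarrow> 'a::real_normed_vector) \<Rightarrow> ereal" where
  "Linf_norm T f = esssup (lebesgue_on {0<..<T}) (\<lambda>t. ereal (norm (f t)))"

definition in_Linf :: "real \<Rightarrow> (real \<Rightarrow> 'a::real_normed_vector) \<Rightarrow> bool" where
  "in_Linf T f \<longleftrightarrow> f \<in> borel_measurable (lebesgue_on {0<..<T}) \<and> Linf_norm T f < \<infinity>"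

definition test_function :: "real \<Rightarrow> (real \<Rightarrow> real) \<Rightarrow> bool" where
  "test_function T \<phi> \<longleftrightarrow>
     (\<forall>n x. (deriv ^^ n) \<phi> field_differentiable (at x)) \<and>
     closure {x. \<phi> x \<noteq> 0} \<subseteq> {0<..<T}"

definition weak_derivative ::
    "real \<Rightarrow> (real \<Rightarrow> 'a::euclidean_space) \<Rightarrow> (real \<Rightarrow> 'a) \<Rightarrow> bool" where
  "weak_derivative T f h \<longleftrightarrow>
     (\<forall>\<phi>. test_function T \<phi> \<longrightarrow>
        (LINT t|lebesgue_on {0<..<T}. deriv \<phi> t *\<^sub>R f t)
          = - (LINT t|lebesgue_on {0<..<T}. \<phi> t *\<^sub>R h t))"

definition in_W1inf :: "real \<Rightarrow> (real \<Rightarrow> 'a::euclidean_space) \<Rightarrow> bool" where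
  "in_W1inf T f \<longleftrightarrow> in_Linf T f \<and> (\<exists>h. in_Linf T h \<and> weak_derivative T f h)"

definition acc ::
    "real \<Rightarrow> real \<Rightarrow> real \<Rightarrow> real \<Rightarrow> real \<Rightarrow> real \<Rightarrow> real \<Rightarrow> real \<Rightarrow> real \<Rightarrow> real" where
  "acc k\<^sub>v k\<^sub>d k \<tau>\<^sub>s x\<^sub>l x v\<^sub>l v u =
     min (k\<^sub>v * ((v\<^sub>l - v) / (x\<^sub>l - x)\<^sup>2) + k\<^sub>d * (x\<^sub>l - x - \<tau>\<^sub>s * v)) (k * (u - v))"

(* Components are ordered (leader position, follower position, leader velocity,
   follower velocity). *)
definition state_space :: "real \<Rightarrow> (real \<times> real \<times> real \<times> real) set" where
  "state_space vbar = {(x\<^sub>1, x\<^sub>2, v\<^sub>1, v\<^sub>2). x\<^sub>1 - x\<^sub>2 > 0 \<and> v\<^sub>1 \<in> {0..vbar} \<and> v\<^sub>2 \<in> {0..vbar}}"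

definition vector_field ::
    "real \<Rightarrow> real \<Rightarrow> real \<Rightarrow> real \<Rightarrow> (real \<Rightarrow> real) \<Rightarrow> (real \<Rightarrow> real) \<Rightarrow> real
      \<Rightarrow> real \<times> real \<times> real \<times> real \<Rightarrow> real \<times> real \<times> real \<times> real" where
  "vector_field k\<^sub>v k\<^sub>d k \<tau>\<^sub>s u b t =
     (\<lambda>(x\<^sub>l, x, v\<^sub>l, v). (v\<^sub>l, v, b t, acc k\<^sub>v k\<^sub>d k \<tau>\<^sub>s x\<^sub>l x v\<^sub>l v (u t)))"

(* b is the leader acceleration. A W^{1,infinity} solution is represented by its
   continuous representative on {0..T}. *)
definition is_solution ::
    "real \<Rightarrow> real \<Rightarrow> real \<Rightarrow> real \<Rightarrow> real \<Rightarrow> real \<Rightarrow> (real \<Rightarrow> real) \<Rightarrow> (real \<Rightarrow> real)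
      \<Rightarrow> real \<times> real \<times> real \<times> real \<Rightarrow> (real \<Rightarrow> real \<times> real \<times> real \<times> real) \<Rightarrow> bool" where
  "is_solution k\<^sub>v k\<^sub>d k \<tau>\<^sub>s vbar T u b z\<^sub>0 z \<longleftrightarrow>
     in_W1inf T z \<and>
     continuous_on {0..T} z \<and>
     (\<forall>t\<in>{0..T}. z t \<in> state_space vbar) \<and>
     (\<forall>t\<in>{0..T}. ((\<lambda>s. vector_field k\<^sub>v k\<^sub>d k \<tau>\<^sub>s u b s (z s)) has_integral (z t - z\<^sub>0)) {0..t})"

end

theory Submission
  imports Defs
begin

text \<open>
  Subtracting the two systems, the errors \<open>p\<close> in the gap, \<open>q\<close> in the leader velocity and \<open>w\<close> in the
  follower velocity start at \<open>0\<close>. The error \<open>q\<close> is \<open>\<epsilon>\<close> times a primitive of \<open>g\<close>, hence \<open>O(\<epsilon>)\<close>, and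
  the other two are driven by \<open>q - w\<close> and by the difference of the accelerations. The acceleration
  is Lipschitz in its arguments as long as the gap stays away from \<open>0\<close>
  (\<open>acc_lipschitz\<close>), so Gronwall's inequality bounds \<open>E = \<bar>p\<bar> + \<bar>q\<bar> + \<bar>w\<bar>\<close> by \<open>O(\<epsilon>)\<close> as long as the
  gaps of both solutions have a common positive lower bound.

  The unperturbed gap is continuous and positive on a compact interval, so it is at least some
  \<open>2 d > 0\<close>, whereas the perturbed gap has no lower bound that is uniform in \<open>\<epsilon>\<close> a priori. The
  circularity is broken by a continuity argument: as long as \<open>E \<le> d\<close>, the perturbed gap is at least
  \<open>d\<close>, so Gronwall applies and, for small \<open>\<epsilon>\<close>, returns a strictly better bound than \<open>d\<close>; hence \<open>E\<close> can
  never reach \<open>d\<close>. The lemma \<open>bootstrap_gronwall\<close> does Gronwall and continuation at once, and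
  \<open>error_estimate\<close> applies it to the two systems.
\<close>

section \<open>Gronwall's inequality with continuation\<close>

text \<open>
  The integral inequality is only required up to times before which the desired bound already holds.
  At the first time \<open>t\<close> where \<open>E\<close> touches the curve \<open>b exp(M t)\<close>, integrating the bound gives
  \<open>E t \<le> a + b (exp(M t) - 1)\<close>, which lies strictly below the curve because \<open>a < b\<close>.
\<close>
lemma bootstrap_gronwall:
  fixes E :: "real \<Rightarrow> real"
  assumes cont: "continuous_on {0..T} E" and start: "E 0 < b" and "a < b" and "M > 0"
    and step: "\<And>t. t \<in> {0..T} \<Longrightarrow> (\<And>s. s \<in> {0..t} \<Longrightarrow> E s \<le> b * exp (M * s)) \<Longrightarrow>
                 E t \<le> a + M * integral {0..t} E"
    and "t \<in> {0..T}"
  shows "E t < b * exp (M * t)"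
proof (rule ccontr)
  assume contra: "\<not> E t < b * exp (M * t)"
  define \<psi> where "\<psi> = (\<lambda>s. E s - b * exp (M * s))"
  have \<psi>_cont: "continuous_on {0..T} \<psi>"
    unfolding \<psi>_def by (intro continuous_intros cont)
  have \<psi>_root: "\<exists>r\<in>{0..s}. \<psi> r = 0" if "s \<in> {0..T}" "\<psi> s \<ge> 0" for s
  proof -
    have "\<psi> 0 \<le> 0"
      using start by (simp add: \<psi>_def)
    moreover have "continuous_on {0..s} \<psi>"
      using \<psi>_cont by (rule continuous_on_subset) (use that in auto)
    ultimately show ?thesis
      using IVT'[of \<psi> 0 0 s] that by auto
  qed
  define R where "R = {0..T} \<inter> \<psi> -` {0}"
  have "closed R"
    unfolding R_def by (rule continuous_closed_preimage[OF \<psi>_cont]) auto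
  have "R \<noteq> {}"
    using \<psi>_root[of t] contra \<open>t \<in> {0..T}\<close> by (force simp: R_def \<psi>_def)
  have "bdd_below R"
    by (rule bdd_belowI[of _ 0]) (auto simp: R_def)
  define t\<^sub>0 where "t\<^sub>0 = Inf R"
  have "t\<^sub>0 \<in> R"
    unfolding t\<^sub>0_def by (rule closed_contains_Inf) fact+
  then have t\<^sub>0: "t\<^sub>0 \<in> {0..T}" "E t\<^sub>0 = b * exp (M * t\<^sub>0)"
    by (auto simp: R_def \<psi>_def)
  have below: "E s \<le> b * exp (M * s)" if s: "s \<in> {0..t\<^sub>0}" for s
  proof (rule ccontr)
    assume "\<not> E s \<le> b * exp (M * s)"
    then have "\<psi> s > 0"
      by (simp add: \<psi>_def)
    then obtain r where r: "r \<in> {0..s}" "\<psi> r = 0"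
      using \<psi>_root[of s] s t\<^sub>0 by auto
    have "r \<in> R"
      using r s t\<^sub>0 by (auto simp: R_def)
    then have "t\<^sub>0 \<le> r"
      unfolding t\<^sub>0_def using \<open>bdd_below R\<close> by (rule cInf_lower)
    then have "r = s"
      using r s by auto
    then show False
      using r \<open>\<psi> s > 0\<close> by simp
  qed
  have exp_int: "((\<lambda>s. M * (b * exp (M * s))) has_integral (b * exp (M * t\<^sub>0) - b * exp (M * 0))) {0..t\<^sub>0}"
    by (rule fundamental_theorem_of_calculus)
      (use t\<^sub>0 in \<open>auto intro!: derivative_eq_intros simp flip: has_real_derivative_iff_has_vector_derivative\<close>)
  have E_int: "(\<lambda>s. M * E s) integrable_on {0..t\<^sub>0}"
    by (intro integrable_continuous_real continuous_intros continuous_on_subset[OF cont]) (use t\<^sub>0 in auto)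
  have "M * integral {0..t\<^sub>0} E = integral {0..t\<^sub>0} (\<lambda>s. M * E s)"
    by simp
  also have "\<dots> \<le> integral {0..t\<^sub>0} (\<lambda>s. M * (b * exp (M * s)))"
    by (rule integral_le[OF E_int has_integral_integrable[OF exp_int]])
      (use below \<open>M > 0\<close> in auto)
  also have "\<dots> = b * exp (M * t\<^sub>0) - b"
    using integral_unique[OF exp_int] by simp
  finally show False
    using step[OF t\<^sub>0(1) below] t\<^sub>0(2) \<open>a < b\<close> by simp
qed

section \<open>Lipschitz continuity of the acceleration away from collision\<close>

lemma abs_min_diff_le:
  fixes a b c d :: real
  shows "\<bar>min a b - min c d\<bar> \<le> \<bar>a - c\<bar> + \<bar>b - d\<bar>"
  by linarith

lemma inverse_square_lipschitz:
  fixes X Y d :: real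
  assumes "d > 0" "X \<ge> d" "Y \<ge> d"
  shows "\<bar>1 / X\<^sup>2 - 1 / Y\<^sup>2\<bar> \<le> 2 / d ^ 3 * \<bar>X - Y\<bar>"
proof -
  have pos: "X > 0" "Y > 0"
    using assms by auto
  have "1 / X\<^sup>2 - 1 / Y\<^sup>2 = (1 / (X * Y\<^sup>2) + 1 / (X\<^sup>2 * Y)) * (Y - X)"
    using pos by (simp add: field_simps power2_eq_square)
  then have eq: "\<bar>1 / X\<^sup>2 - 1 / Y\<^sup>2\<bar> = (1 / (X * Y\<^sup>2) + 1 / (X\<^sup>2 * Y)) * \<bar>X - Y\<bar>"
    using pos by (simp add: abs_mult abs_minus_commute)
  have "d * d\<^sup>2 \<le> X * Y\<^sup>2" "d\<^sup>2 * d \<le> X\<^sup>2 * Y"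
    using assms by (auto intro!: mult_mono power_mono)
  then have "1 / (X * Y\<^sup>2) \<le> 1 / d ^ 3" "1 / (X\<^sup>2 * Y) \<le> 1 / d ^ 3"
    using assms pos by (auto intro!: divide_left_mono simp: power3_eq_cube power2_eq_square mult.assoc)
  then have "1 / (X * Y\<^sup>2) + 1 / (X\<^sup>2 * Y) \<le> 2 / d ^ 3"
    by simp
  then show ?thesis
    unfolding eq by (rule mult_right_mono) simp
qed

definition acc_lip :: "real \<Rightarrow> real \<Rightarrow> real \<Rightarrow> real \<Rightarrow> real \<Rightarrow> real \<Rightarrow> real" where
  "acc_lip k\<^sub>v k\<^sub>d k \<tau>\<^sub>s vbar d = k\<^sub>v * (1 / d\<^sup>2 + vbar * (2 / d ^ 3)) + k\<^sub>d * (1 + \<tau>\<^sub>s) + k"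

text \<open>
  The only singularity of the acceleration is the factor \<open>1 / (x\<^sub>l - x)\<^sup>2\<close>, and it is multiplied
  by a velocity difference bounded by \<open>vbar\<close>.
\<close>
lemma acc_lipschitz:
  assumes pos: "k\<^sub>v > 0" "k\<^sub>d > 0" "k > 0" "\<tau>\<^sub>s > 0" "d > 0"
    and gap: "yl - y \<ge> d" "xl - x \<ge> d"
    and vel: "vl \<in> {0..vbar}" "v \<in> {0..vbar}"
  shows "\<bar>acc k\<^sub>v k\<^sub>d k \<tau>\<^sub>s yl y wl w c - acc k\<^sub>v k\<^sub>d k \<tau>\<^sub>s xl x vl v c\<bar>
           \<le> acc_lip k\<^sub>v k\<^sub>d k \<tau>\<^sub>s vbar d
               * (\<bar>(yl - y) - (xl - x)\<bar> + \<bar>wl - vl\<bar> + \<bar>w - v\<bar>)"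
proof -
  define X Y where "X = xl - x" and "Y = yl - y"
  define p q r where "p = \<bar>Y - X\<bar>" and "q = \<bar>wl - vl\<bar>" and "r = \<bar>w - v\<bar>"
  have nn: "p \<ge> 0" "q \<ge> 0" "r \<ge> 0"
    by (auto simp: p_def q_def r_def)
  have "vbar \<ge> 0"
    using vel by auto
  have "1 / Y\<^sup>2 \<le> 1 / d\<^sup>2"
    using gap pos by (auto intro!: divide_left_mono power_mono simp: Y_def)
  then have I1: "\<bar>((wl - vl) - (w - v)) * (1 / Y\<^sup>2)\<bar> \<le> (q + r) * (1 / d\<^sup>2)"
    unfolding abs_mult by (intro mult_mono) (auto simp: q_def r_def)
  have I2: "\<bar>(vl - v) * (1 / Y\<^sup>2 - 1 / X\<^sup>2)\<bar> \<le> vbar * (2 / d ^ 3 * p)"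
    unfolding abs_mult p_def
    by (intro mult_mono inverse_square_lipschitz) (use gap pos vel in \<open>auto simp: X_def Y_def\<close>)
  have "(wl - w) / Y\<^sup>2 - (vl - v) / X\<^sup>2
          = ((wl - vl) - (w - v)) * (1 / Y\<^sup>2) + (vl - v) * (1 / Y\<^sup>2 - 1 / X\<^sup>2)"
    by (simp add: algebra_simps diff_divide_distrib add_divide_distrib)
  then have I: "\<bar>(wl - w) / Y\<^sup>2 - (vl - v) / X\<^sup>2\<bar> \<le> (q + r) * (1 / d\<^sup>2) + vbar * (2 / d ^ 3 * p)"
    using I1 I2 by linarith
  have "\<bar>(Y - \<tau>\<^sub>s * w) - (X - \<tau>\<^sub>s * v)\<bar> \<le> p + \<bar>\<tau>\<^sub>s * (w - v)\<bar>"
    by (simp add: p_def algebra_simps)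
  then have J: "\<bar>(Y - \<tau>\<^sub>s * w) - (X - \<tau>\<^sub>s * v)\<bar> \<le> p + \<tau>\<^sub>s * r"
    using pos by (simp add: r_def abs_mult)
  have "\<bar>acc k\<^sub>v k\<^sub>d k \<tau>\<^sub>s yl y wl w c - acc k\<^sub>v k\<^sub>d k \<tau>\<^sub>s xl x vl v c\<bar>
      \<le> \<bar>(k\<^sub>v * ((wl - w) / Y\<^sup>2) + k\<^sub>d * (Y - \<tau>\<^sub>s * w)) - (k\<^sub>v * ((vl - v) / X\<^sup>2) + k\<^sub>d * (X - \<tau>\<^sub>s * v))\<bar>
        + \<bar>k * (c - w) - k * (c - v)\<bar>"
    unfolding acc_def X_def Y_def by (rule abs_min_diff_le)
  also have "\<dots> = \<bar>k\<^sub>v * ((wl - w) / Y\<^sup>2 - (vl - v) / X\<^sup>2) + k\<^sub>d * ((Y - \<tau>\<^sub>s * w) - (X - \<tau>\<^sub>s * v))\<bar>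
        + \<bar>k * (w - v)\<bar>"
    by (simp add: algebra_simps abs_minus_commute)
  also have "\<dots> \<le> k\<^sub>v * \<bar>(wl - w) / Y\<^sup>2 - (vl - v) / X\<^sup>2\<bar> + k\<^sub>d * \<bar>(Y - \<tau>\<^sub>s * w) - (X - \<tau>\<^sub>s * v)\<bar> + k * r"
    using pos by (intro add_mono order_trans[OF abs_triangle_ineq]) (auto simp: abs_mult r_def)
  also have "\<dots> \<le> k\<^sub>v * ((q + r) * (1 / d\<^sup>2) + vbar * (2 / d ^ 3 * p)) + k\<^sub>d * (p + \<tau>\<^sub>s * r) + k * r"
    using pos I J by (intro add_mono mult_left_mono) auto
  also have "\<dots> \<le> k\<^sub>v * ((p + q + r) * (1 / d\<^sup>2) + vbar * (2 / d ^ 3 * (p + q + r)))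
        + k\<^sub>d * ((p + q + r) + \<tau>\<^sub>s * (p + q + r)) + k * (p + q + r)"
    using pos nn \<open>vbar \<ge> 0\<close> by (intro add_mono mult_left_mono mult_right_mono) auto
  also have "\<dots> = acc_lip k\<^sub>v k\<^sub>d k \<tau>\<^sub>s vbar d * (p + q + r)"
    by (simp add: acc_lip_def algebra_simps)
  finally show ?thesis
    by (simp add: p_def q_def r_def X_def Y_def)
qed

section \<open>Stability of solutions\<close>

lemma is_solution_components:
  assumes "is_solution k\<^sub>v k\<^sub>d k \<tau>\<^sub>s vbar T u b (xl\<^sub>0, x\<^sub>0, vl\<^sub>0, v\<^sub>0) (\<lambda>t. (xl t, x t, vl t, v t))"
  shows "continuous_on {0..T} xl" "continuous_on {0..T} x"
    and "continuous_on {0..T} vl" "continuous_on {0..T} v"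
    and "\<And>t. t \<in> {0..T} \<Longrightarrow> xl t - x t > 0"
    and "\<And>t. t \<in> {0..T} \<Longrightarrow> vl t \<in> {0..vbar}"
    and "\<And>t. t \<in> {0..T} \<Longrightarrow> v t \<in> {0..vbar}"
    and "\<And>t. t \<in> {0..T} \<Longrightarrow> (vl has_integral (xl t - xl\<^sub>0)) {0..t}"
    and "\<And>t. t \<in> {0..T} \<Longrightarrow> (v has_integral (x t - x\<^sub>0)) {0..t}"
    and "\<And>t. t \<in> {0..T} \<Longrightarrow> (b has_integral (vl t - vl\<^sub>0)) {0..t}"
    and "\<And>t. t \<in> {0..T} \<Longrightarrow>
           ((\<lambda>s. acc k\<^sub>v k\<^sub>d k \<tau>\<^sub>s (xl s) (x s) (vl s) (v s) (u s)) has_integral (v t - v\<^sub>0)) {0..t}"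
proof -
  let ?z = "\<lambda>t. (xl t, x t, vl t, v t)"
  have cont: "continuous_on {0..T} ?z"
    and state: "\<And>t. t \<in> {0..T} \<Longrightarrow> ?z t \<in> state_space vbar"
    and eqn: "\<And>t. t \<in> {0..T} \<Longrightarrow>
      ((\<lambda>s. (vl s, v s, b s, acc k\<^sub>v k\<^sub>d k \<tau>\<^sub>s (xl s) (x s) (vl s) (v s) (u s)))
        has_integral (?z t - (xl\<^sub>0, x\<^sub>0, vl\<^sub>0, v\<^sub>0))) {0..t}"
    using assms by (auto simp: is_solution_def vector_field_def)
  note c1 = continuous_on_snd[OF cont]
  note c2 = continuous_on_snd[OF c1]
  show "continuous_on {0..T} xl" "continuous_on {0..T} x"
    "continuous_on {0..T} vl" "continuous_on {0..T} v"
    using continuous_on_fst[OF cont] continuous_on_fst[OF c1] continuous_on_fst[OF c2]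
      continuous_on_snd[OF c2] by simp_all
  show "xl t - x t > 0" "vl t \<in> {0..vbar}" "v t \<in> {0..vbar}" if "t \<in> {0..T}" for t
    using state[OF that] by (auto simp: state_space_def)
  fix t assume t: "t \<in> {0..T}"
  note i1 = has_integral_linear[OF eqn[OF t] bounded_linear_snd]
  note i2 = has_integral_linear[OF i1 bounded_linear_snd]
  show "(vl has_integral (xl t - xl\<^sub>0)) {0..t}" "(v has_integral (x t - x\<^sub>0)) {0..t}"
    "(b has_integral (vl t - vl\<^sub>0)) {0..t}"
    "((\<lambda>s. acc k\<^sub>v k\<^sub>d k \<tau>\<^sub>s (xl s) (x s) (vl s) (v s) (u s)) has_integral (v t - v\<^sub>0)) {0..t}"
    using has_integral_linear[OF eqn[OF t] bounded_linear_fst]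
      has_integral_linear[OF i1 bounded_linear_fst]
      has_integral_linear[OF i2 bounded_linear_fst]
      has_integral_linear[OF i2 bounded_linear_snd]
    by (simp_all add: o_def)
qed

lemma has_integral_abs_le:
  fixes f h :: "real \<Rightarrow> real"
  assumes "(f has_integral I) S" "h integrable_on S" "\<And>s. s \<in> S \<Longrightarrow> \<bar>f s\<bar> \<le> h s"
  shows "\<bar>I\<bar> \<le> integral S h"
  using integral_norm_bound_integral[of f S h] assms
  by (auto simp: integral_unique has_integral_integrable)

text \<open>
  The bound on \<open>e\<close> in terms of \<open>d\<close> keeps the perturbed gap above \<open>d\<close> as long as the
  asserted estimate holds, which is what allows \<open>bootstrap_gronwall\<close> to close. The factor \<open>2\<close> in
  the conclusion is the room between \<open>a\<close> and \<open>b\<close> there.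
\<close>
lemma error_estimate:
  assumes pos: "k\<^sub>v > 0" "k\<^sub>d > 0" "k > 0" "\<tau>\<^sub>s > 0" "d > 0" "e > 0"
    and sol': "is_solution k\<^sub>v k\<^sub>d k \<tau>\<^sub>s vbar T u (\<lambda>t. a\<^sub>l t + f t) (xl\<^sub>0, x\<^sub>0, vl\<^sub>0, v\<^sub>0)
                 (\<lambda>t. (xl' t, x' t, vl' t, v' t))"
    and sol: "is_solution k\<^sub>v k\<^sub>d k \<tau>\<^sub>s vbar T u a\<^sub>l (xl\<^sub>0, x\<^sub>0, vl\<^sub>0, v\<^sub>0)
                 (\<lambda>t. (xl t, x t, vl t, v t))"
    and gap: "\<And>t. t \<in> {0..T} \<Longrightarrow> xl t - x t \<ge> 2 * d"
    and f: "\<And>t I. t \<in> {0..T} \<Longrightarrow> (f has_integral I) {0..t} \<Longrightarrow> \<bar>I\<bar> \<le> e"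
    and M: "M = acc_lip k\<^sub>v k\<^sub>d k \<tau>\<^sub>s vbar d + 1"
    and small: "2 * e * exp (M * T) \<le> d"
    and t: "t \<in> {0..T}"
  shows "\<bar>(xl' t - x' t) - (xl t - x t)\<bar> + \<bar>vl' t - vl t\<bar> + \<bar>v' t - v t\<bar> \<le> 2 * e * exp (M * T)"
proof -
  note S = is_solution_components[OF sol] and S' = is_solution_components[OF sol']
  define p q w where "p = (\<lambda>t. (xl' t - x' t) - (xl t - x t))"
    and "q = (\<lambda>t. vl' t - vl t)" and "w = (\<lambda>t. v' t - v t)"
  define E where "E = (\<lambda>t. \<bar>p t\<bar> + \<bar>q t\<bar> + \<bar>w t\<bar>)"
  define L where "L = acc_lip k\<^sub>v k\<^sub>d k \<tau>\<^sub>s vbar d"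
  have "vbar \<ge> 0"
    using S(6)[OF t] by auto
  then have "L \<ge> 0"
    using pos by (simp add: L_def acc_lip_def)
  then have "M > 0"
    by (simp add: M L_def)
  have cont: "continuous_on {0..T} E"
    unfolding E_def p_def q_def w_def by (intro continuous_intros S(1-4) S'(1-4))
  have p_int: "((\<lambda>s. q s - w s) has_integral p s) {0..s}" if "s \<in> {0..T}" for s
    using has_integral_diff[OF has_integral_diff[OF S'(8,9)[OF that]] has_integral_diff[OF S(8,9)[OF that]]]
    by (simp add: p_def q_def w_def algebra_simps)
  have q_int: "(f has_integral q s) {0..s}" if "s \<in> {0..T}" for s
    using has_integral_diff[OF S'(10)[OF that] S(10)[OF that]] by (simp add: q_def)
  have w_int: "((\<lambda>s. acc k\<^sub>v k\<^sub>d k \<tau>\<^sub>s (xl' s) (x' s) (vl' s) (v' s) (u s)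
      - acc k\<^sub>v k\<^sub>d k \<tau>\<^sub>s (xl s) (x s) (vl s) (v s) (u s)) has_integral w s) {0..s}"
    if "s \<in> {0..T}" for s
    using has_integral_diff[OF S'(11)[OF that] S(11)[OF that]] by (simp add: w_def)
  have "0 \<in> {0..T}"
    using t by auto
  moreover have "I = 0" if "(h has_integral I) {0..0}" for h :: "real \<Rightarrow> real" and I
    using that by (rule has_integral_unique) (rule has_integral_null_real, simp)
  ultimately have "p 0 = 0" "q 0 = 0" "w 0 = 0"
    using p_int[of 0] q_int[of 0] w_int[of 0] by blast+
  then have "E 0 = 0"
    by (simp add: E_def)
  have step: "E r \<le> e + M * integral {0..r} E"
    if r: "r \<in> {0..T}" and le: "\<And>s. s \<in> {0..r} \<Longrightarrow> E s \<le> 2 * e * exp (M * s)" for r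
  proof -
    have E_int: "E integrable_on {0..r}"
      by (intro integrable_continuous_real continuous_on_subset[OF cont]) (use r in auto)
    have "\<bar>p r\<bar> \<le> integral {0..r} E"
      by (rule has_integral_abs_le[OF p_int[OF r] E_int]) (simp add: E_def)
    moreover have "\<bar>q r\<bar> \<le> e"
      using f[OF r q_int[OF r]] .
    moreover have "\<bar>w r\<bar> \<le> integral {0..r} (\<lambda>s. L * E s)"
    proof (rule has_integral_abs_le[OF w_int[OF r]])
      show "(\<lambda>s. L * E s) integrable_on {0..r}"
        using integrable_cmul[OF E_int, of L] by simp
      fix s assume s: "s \<in> {0..r}"
      then have sT: "s \<in> {0..T}"
        using r by auto
      have "2 * e * exp (M * s) \<le> 2 * e * exp (M * T)"
        using sT pos \<open>M > 0\<close> by simp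
      then have "\<bar>p s\<bar> \<le> d"
        using le[OF s] small by (simp add: E_def)
      then have "xl' s - x' s \<ge> d" "xl s - x s \<ge> d"
        using gap[OF sT] pos by (auto simp: p_def)
      then show "\<bar>acc k\<^sub>v k\<^sub>d k \<tau>\<^sub>s (xl' s) (x' s) (vl' s) (v' s) (u s)
          - acc k\<^sub>v k\<^sub>d k \<tau>\<^sub>s (xl s) (x s) (vl s) (v s) (u s)\<bar> \<le> L * E s"
        unfolding L_def E_def p_def q_def w_def
        by (intro acc_lipschitz pos S(6,7)[OF sT])
    qed
    ultimately have "E r \<le> e + integral {0..r} E + L * integral {0..r} E"
      unfolding fun_cong[OF E_def, of r] by simp
    then show ?thesis
      by (simp add: M L_def algebra_simps)
  qed
  have "E t < 2 * e * exp (M * t)"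
    by (rule bootstrap_gronwall[OF cont _ _ \<open>M > 0\<close> step t]) (use \<open>E 0 = 0\<close> pos in auto)
  also have "\<dots> \<le> 2 * e * exp (M * T)"
    using t pos \<open>M > 0\<close> by simp
  finally show ?thesis
    by (simp add: E_def p_def q_def w_def)
qed

section \<open>Bounds for the essential supremum norm\<close>

lemma Linf_norm_nonneg:
  assumes "T > 0"
  shows "0 \<le> Linf_norm T f"
proof -
  have "emeasure (lebesgue_on {0<..<T}) (space (lebesgue_on {0<..<T})) \<noteq> 0"
    using assms by (simp add: emeasure_restrict_space)
  then have "0 = esssup (lebesgue_on {0<..<T}) (\<lambda>_. 0 :: ereal)"
    by (simp add: esssup_const)
  also have "\<dots> \<le> Linf_norm T f"
    unfolding Linf_norm_def by (rule esssup_mono) auto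
  finally show ?thesis .
qed

lemma Linf_norm_le:
  fixes f :: "real \<Rightarrow> 'a::euclidean_space"
  assumes "continuous_on {0..T} f" "\<And>t. t \<in> {0..T} \<Longrightarrow> norm (f t) \<le> c"
  shows "Linf_norm T f \<le> ereal c"
  unfolding Linf_norm_def
proof (rule esssup_I)
  have "continuous_on {0<..<T} (\<lambda>t. norm (f t))"
    by (intro continuous_on_norm continuous_on_subset[OF assms(1)]) auto
  then have "(\<lambda>t. norm (f t)) \<in> borel_measurable (lebesgue_on {0<..<T})"
    by (rule continuous_imp_measurable_on_sets_lebesgue) auto
  then show "(\<lambda>t. ereal (norm (f t))) \<in> borel_measurable (lebesgue_on {0<..<T})"
    by (rule borel_measurable_ereal)
  show "AE t in lebesgue_on {0<..<T}. ereal (norm (f t)) \<le> ereal c"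
    using assms(2) by (intro AE_I2) (auto simp: space_restrict_space)
qed

section \<open>Convergence as the perturbation vanishes\<close>

theorem mainTheorem4:
  fixes k\<^sub>v k\<^sub>d k \<tau>\<^sub>s u_low u_bar v_bar T :: real
    and u a\<^sub>l g :: "real \<Rightarrow> real"
    and xl\<^sub>0 x\<^sub>0 vl\<^sub>0 v\<^sub>0 \<epsilon>\<^sub>0 :: real
    and xl x vl v :: "real \<Rightarrow> real"
    and xl_eps x_eps vl_eps v_eps :: "real \<Rightarrow> real \<Rightarrow> real"
  assumes "k\<^sub>v > 0" and "k\<^sub>d > 0" and "k > 0" and "\<tau>\<^sub>s > 0"
    and "0 < u_low" and "u_low < u_bar" and "u_bar < v_bar"
    and "T > 0"
    and "continuous_on {0..T} u" and "\<And>t. t \<in> {0..T} \<Longrightarrow> u t \<in> {u_low..u_bar}"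
    and "continuous_on {0..T} a\<^sub>l" and "in_Linf T a\<^sub>l"
    and "\<And>t. t \<in> {0..T} \<Longrightarrow> vl\<^sub>0 + integral {0..t} a\<^sub>l \<in> {0..v_bar}"
    and "(xl\<^sub>0, x\<^sub>0, vl\<^sub>0, v\<^sub>0) \<in> state_space v_bar"
    and "\<epsilon>\<^sub>0 > 0"
    and "continuous_on {0..T} g"
    and "L1_norm T g \<le> (1 / \<epsilon>\<^sub>0) * (v_bar - vl\<^sub>0 - L1_norm T a\<^sub>l)"
    and "\<And>\<epsilon>. 0 < \<epsilon> \<Longrightarrow> \<epsilon> \<le> \<epsilon>\<^sub>0 \<Longrightarrow>
           is_solution k\<^sub>v k\<^sub>d k \<tau>\<^sub>s v_bar T u (\<lambda>t. a\<^sub>l t + \<epsilon> * g t) (xl\<^sub>0, x\<^sub>0, vl\<^sub>0, v\<^sub>0)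
             (\<lambda>t. (xl_eps \<epsilon> t, x_eps \<epsilon> t, vl_eps \<epsilon> t, v_eps \<epsilon> t))"
    and "is_solution k\<^sub>v k\<^sub>d k \<tau>\<^sub>s v_bar T u a\<^sub>l (xl\<^sub>0, x\<^sub>0, vl\<^sub>0, v\<^sub>0)
           (\<lambda>t. (xl t, x t, vl t, v t))"
  shows "((\<lambda>\<epsilon>. Linf_norm T (\<lambda>t. (xl_eps \<epsilon> t - x_eps \<epsilon> t, vl_eps \<epsilon> t - v_eps \<epsilon> t)
                                  - (xl t - x t, vl t - v t)))
           \<longlongrightarrow> 0) (at_right 0)"
proof -
  note pos = assms(1-4) and \<open>T > 0\<close>
  note sol = assms(19)
  note sol_eps = assms(18)
  note S = is_solution_components[OF sol]
  have "continuous_on {0..T} (\<lambda>t. xl t - x t)"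
    by (intro continuous_intros S)
  then obtain m where m: "m \<in> {0..T}" "\<And>t. t \<in> {0..T} \<Longrightarrow> xl m - x m \<le> xl t - x t"
    using continuous_attains_inf[of "{0..T}" "\<lambda>t. xl t - x t"] \<open>T > 0\<close> by auto
  define d where "d = (xl m - x m) / 2"
  have "d > 0"
    using S(5)[OF m(1)] by (simp add: d_def)
  have gap: "2 * d \<le> xl t - x t" if "t \<in> {0..T}" for t
    using m(2)[OF that] by (simp add: d_def)
  define M where "M = acc_lip k\<^sub>v k\<^sub>d k \<tau>\<^sub>s v_bar d + 1"
  \<comment> \<open>The summand \<open>1\<close> only makes \<open>G\<close> positive when \<open>g\<close> vanishes identically.\<close>
  define G where "G = integral {0..T} (\<lambda>t. \<bar>g t\<bar>) + 1"
  define C where "C = 2 * G * exp (M * T)"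
  have g_int: "(\<lambda>t. \<bar>g t\<bar>) integrable_on {0..r}" if "r \<in> {0..T}" for r
    by (intro integrable_continuous_real continuous_intros continuous_on_subset[OF assms(16)])
      (use that in auto)
  have "G > 0"
    unfolding G_def by (intro add_nonneg_pos integral_nonneg g_int) (use \<open>T > 0\<close> in auto)
  then have "C > 0"
    by (simp add: C_def)
  have bound: "Linf_norm T (\<lambda>t. (xl_eps \<epsilon> t - x_eps \<epsilon> t, vl_eps \<epsilon> t - v_eps \<epsilon> t)
                               - (xl t - x t, vl t - v t)) \<le> ereal (C * \<epsilon>)"
    if \<epsilon>: "0 < \<epsilon>" "\<epsilon> \<le> \<epsilon>\<^sub>0" "\<epsilon> \<le> d / C" for \<epsilon>
  proof (rule Linf_norm_le)
    note S' = is_solution_components[OF sol_eps[OF \<epsilon>(1,2)]]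
    show "continuous_on {0..T} (\<lambda>t. (xl_eps \<epsilon> t - x_eps \<epsilon> t, vl_eps \<epsilon> t - v_eps \<epsilon> t)
                               - (xl t - x t, vl t - v t))"
      by (intro continuous_intros S(1-4) S'(1-4))
    fix t assume t: "t \<in> {0..T}"
    have "\<bar>I\<bar> \<le> \<epsilon> * G" if r: "r \<in> {0..T}" and I: "((\<lambda>t. \<epsilon> * g t) has_integral I) {0..r}" for r I
    proof -
      have "\<bar>I\<bar> \<le> integral {0..r} (\<lambda>t. \<epsilon> * \<bar>g t\<bar>)"
        using integrable_cmul[OF g_int[OF r], of \<epsilon>] \<epsilon>
        by (intro has_integral_abs_le[OF I]) (auto simp: abs_mult)
      also have "\<dots> = \<epsilon> * integral {0..r} (\<lambda>t. \<bar>g t\<bar>)"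
        by simp
      also have "\<dots> \<le> \<epsilon> * integral {0..T} (\<lambda>t. \<bar>g t\<bar>)"
        using r \<epsilon> by (intro mult_left_mono integral_subset_le g_int) auto
      also have "\<dots> \<le> \<epsilon> * G"
        using \<epsilon> by (simp add: G_def)
      finally show ?thesis .
    qed
    moreover have "2 * (\<epsilon> * G) * exp (M * T) \<le> d"
      using \<epsilon>(3) \<open>C > 0\<close> by (simp add: C_def field_simps)
    ultimately have "\<bar>(xl_eps \<epsilon> t - x_eps \<epsilon> t) - (xl t - x t)\<bar> + \<bar>vl_eps \<epsilon> t - vl t\<bar>
        + \<bar>v_eps \<epsilon> t - v t\<bar> \<le> 2 * (\<epsilon> * G) * exp (M * T)"
      using \<epsilon> \<open>G > 0\<close>
      by (intro error_estimate[OF pos \<open>d > 0\<close> _ sol_eps[OF \<epsilon>(1,2)] sol gap _ M_def _ t]) auto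
    then have "\<bar>(xl_eps \<epsilon> t - x_eps \<epsilon> t) - (xl t - x t)\<bar>
        + \<bar>(vl_eps \<epsilon> t - v_eps \<epsilon> t) - (vl t - v t)\<bar> \<le> C * \<epsilon>"
      by (simp add: C_def algebra_simps)
    moreover have "norm (a, b) \<le> \<bar>a\<bar> + \<bar>b\<bar>" for a b :: real
      by (simp add: norm_Pair sqrt_sum_squares_le_sum_abs)
    ultimately show "norm ((xl_eps \<epsilon> t - x_eps \<epsilon> t, vl_eps \<epsilon> t - v_eps \<epsilon> t)
                               - (xl t - x t, vl t - v t)) \<le> C * \<epsilon>"
      unfolding diff_Pair by (rule order_trans[rotated])
  qed
  have lim: "((\<lambda>\<epsilon>. ereal (C * \<epsilon>)) \<longlongrightarrow> 0) (at_right 0)"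
    unfolding zero_ereal_def
    by (intro tendsto_ereal) (auto intro!: tendsto_eq_intros)
  have small: "eventually (\<lambda>\<epsilon>. 0 < \<epsilon> \<and> \<epsilon> < min \<epsilon>\<^sub>0 (d / C)) (at_right 0)"
    using eventually_at_right_real[of 0 "min \<epsilon>\<^sub>0 (d / C)"] \<open>d > 0\<close> \<open>C > 0\<close> \<open>\<epsilon>\<^sub>0 > 0\<close> by simp
  show ?thesis
  proof (rule tendsto_sandwich[OF _ _ tendsto_const lim])
    show "\<forall>\<^sub>F \<epsilon> in at_right 0. 0 \<le> Linf_norm T (\<lambda>t. (xl_eps \<epsilon> t - x_eps \<epsilon> t, vl_eps \<epsilon> t - v_eps \<epsilon> t)
                                  - (xl t - x t, vl t - v t))"
      by (intro always_eventually allI Linf_norm_nonneg[OF \<open>T > 0\<close>])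
    show "\<forall>\<^sub>F \<epsilon> in at_right 0. Linf_norm T (\<lambda>t. (xl_eps \<epsilon> t - x_eps \<epsilon> t, vl_eps \<epsilon> t - v_eps \<epsilon> t)
                                  - (xl t - x t, vl t - v t)) \<le> ereal (C * \<epsilon>)"
      using small by eventually_elim (rule bound; simp)
  qed
qed

end
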